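(* For each $n$, let $G_n$ be a finite graph with $n$ vertices and maximum degree $\Delta_n$, let $q_n\ge\Delta_n+2$, and let $X^{(n)}$ be the number of rounds until all players have payoff $1$ (the conflict resolving time) in the self-organizing network coloring game on $G_n$ with $q_n$ colors in which all players use the greedy and selfish strategy, started from an arbitrary initial state. Then $X^{(n)}=O_p(\log n)$: for every $\varepsilon>0$ there exist $M>0$ and $n_0$ such that $\Pr\big[X^{(n)}/\log n> M\big]<\varepsilon$ for all $n>n_0$.
   Context: Network coloring game: players are the vertices $1,\dots,n$ of the graph; $N(i)$ denotes the neighbours of $i$. There are $q$ colors. In discrete rounds $t=0,1,2,\dots$ each player $i$ holds a color $l_i(t)$ and has payoff $U_i(t)=1$ if $l_i(t)\ne l_j(t)$ for all $j\in N(i)$ and $U_i(t)=0$ otherwise. Greedy and selfish strategy: a player with payoff $1$ keeps its color; a player with payoff $0$ chooses its next color uniformly at random among the colors not used by any of its neighbours in the previous round, independently of the other players. The game has converged once all payoffs equal $1$. *)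

theory Defs
  imports "HOL-Probability.Probability"
begin

text \<open>
  The players are \<open>1, \<dots>, n\<close>, the colors are \<open>1, \<dots>, q\<close>, and a state assigns a color to every
  player; states are extensional functions, i.e. undefined outside \<open>{1..n}\<close>.
\<close>

definition simple_graph :: "nat \<Rightarrow> nat rel \<Rightarrow> bool" where
  "simple_graph n E \<longleftrightarrow> E \<subseteq> {1..n} \<times> {1..n} \<and> sym E \<and> irrefl E"

definition neighbours :: "nat rel \<Rightarrow> nat \<Rightarrow> nat set" where
  "neighbours E i = {j. (i, j) \<in> E}"

definition max_degree :: "nat \<Rightarrow> nat rel \<Rightarrow> nat" where
  "max_degree n E = Max ((\<lambda>i. card (neighbours E i)) ` {1..n})"

definition states :: "nat \<Rightarrow> nat \<Rightarrow> (nat \<Rightarrow> nat) set" where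
  "states n q = {1..n} \<rightarrow>\<^sub>E {1..q}"

definition payoff :: "nat rel \<Rightarrow> (nat \<Rightarrow> nat) \<Rightarrow> nat \<Rightarrow> nat" where
  "payoff E l i = (if \<forall>j\<in>neighbours E i. l i \<noteq> l j then 1 else 0)"

definition next_color :: "nat \<Rightarrow> nat rel \<Rightarrow> (nat \<Rightarrow> nat) \<Rightarrow> nat \<Rightarrow> nat pmf" where
  "next_color q E l i =
     (if payoff E l i = 1 then return_pmf (l i)
      else pmf_of_set ({1..q} - l ` neighbours E i))"

text \<open>The product distribution expresses that the players choose independently of each other.\<close>

definition next_state :: "nat \<Rightarrow> nat \<Rightarrow> nat rel \<Rightarrow> (nat \<Rightarrow> nat) \<Rightarrow> (nat \<Rightarrow> nat) pmf" where
  "next_state n q E l = Pi_pmf {1..n} undefined (next_color q E l)"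

text \<open>
  The play is a Markov chain \<open>L 0, L 1, \<dots>\<close> on a probability space \<open>M\<close>: whatever the history
  \<open>h 0, \<dots>, h t\<close>, the conditional law of \<open>L (t + 1)\<close> given that history is
  \<open>next_state n q E (h t)\<close>. The condition is written without division so that it
  also makes sense for histories of probability 0.
\<close>

definition greedy_selfish_game ::
  "'a measure \<Rightarrow> nat \<Rightarrow> nat \<Rightarrow> nat rel \<Rightarrow> (nat \<Rightarrow> nat) \<Rightarrow> (nat \<Rightarrow> 'a \<Rightarrow> nat \<Rightarrow> nat) \<Rightarrow> bool" where
  "greedy_selfish_game M n q E l0 L \<longleftrightarrow>
     prob_space M \<and>
     (\<forall>t. L t \<in> M \<rightarrow>\<^sub>M count_space UNIV) \<and>
     (\<forall>\<omega>\<in>space M. L 0 \<omega> = l0) \<and>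
     (\<forall>t h. \<P>(\<omega> in M. \<forall>s\<le>Suc t. L s \<omega> = h s) =
            \<P>(\<omega> in M. \<forall>s\<le>t. L s \<omega> = h s) * pmf (next_state n q E (h t)) (h (Suc t)))"

text \<open>The infimum of the empty set is \<open>\<infinity>\<close>: a play that never converges has infinite resolving time.\<close>

definition resolving_time :: "nat \<Rightarrow> nat rel \<Rightarrow> (nat \<Rightarrow> nat \<Rightarrow> nat) \<Rightarrow> enat" where
  "resolving_time n E l = Inf (enat ` {t. \<forall>i\<in>{1..n}. payoff E (l t) i = 1})"

end

theory Submission
  imports Defs
begin

text \<open>
  A happy player (payoff 1) stays happy forever. Consider any other player, with \<open>k\<close> free colors and
  \<open>d\<close> unhappy neighbours. Every player always has at least two free colors, so each color is picked by
  a given unhappy neighbour with probability at most 1/2, and by convexity (\<open>1 - x \<ge> exp (- 2 x)\<close>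
  and Jensen) the player becomes happy in the next round with probability at least
  \<open>exp (- 2 d / k)\<close>. The ratio \<open>d / k\<close> may be large, but after one round it is bounded with
  constant probability. Hence two rounds make a player happy with probability at least an absolute
  constant \<open>p\<close>, and by the union bound the game is unresolved after \<open>2 t\<close> rounds with probability at
  most \<open>n (1 - p)\<^sup>t\<close>.
\<close>

section \<open>Lower bounds for sums of products\<close>

lemma exp_minus_double_le_one_minus:
  fixes x :: real
  assumes "0 \<le> x" "x \<le> 1 / 2"
  shows "exp (- 2 * x) \<le> 1 - x"
proof -
  \<comment> \<open>This absorbs the quadratic error in
    \<open>- x - 2 * x\<^sup>2 \<le> ln (1 - x)\<close>.\<close>
  have "2 * x\<^sup>2 \<le> x"
    using assms mult_right_mono[of "2 * x" 1 x] by (simp add: power2_eq_square)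
  then have "- 2 * x \<le> ln (1 - x)"
    using ln_one_minus_pos_lower_bound[of x] assms by linarith
  then show ?thesis
    using assms by (subst (asm) ln_ge_iff) auto
qed

text \<open>Each product is at least \<open>exp (- 2 * s c)\<close>, where \<open>s c\<close> is the
  column sum of \<open>x\<close>. Since every row sums to at most 1, the average of \<open>s\<close>
  over \<open>C\<close> is at most \<open>card U / card C\<close>, and convexity of the exponential
  gives the bound.\<close>

lemma sum_prod_one_minus_ge:
  fixes x :: "'u \<Rightarrow> 'c \<Rightarrow> real"
  assumes "finite C" "C \<noteq> {}" "finite U"
    and x: "\<And>u c. u \<in> U \<Longrightarrow> c \<in> C \<Longrightarrow> 0 \<le> x u c \<and> x u c \<le> 1 / 2"
    and sum_le: "\<And>u. u \<in> U \<Longrightarrow> (\<Sum>c\<in>C. x u c) \<le> 1"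
  shows "card C * exp (- 2 * (card U / card C)) \<le> (\<Sum>c\<in>C. \<Prod>u\<in>U. 1 - x u c)"
proof -
  define m where "m = real (card U) / card C"
  define s where "s c = (\<Sum>u\<in>U. x u c)" for c
  have "card C > 0"
    using assms by (simp add: card_gt_0_iff)
  have "(\<Sum>c\<in>C. s c) = (\<Sum>u\<in>U. \<Sum>c\<in>C. x u c)"
    unfolding s_def by (rule sum.swap)
  also have "\<dots> \<le> (\<Sum>u\<in>U. 1)"
    by (intro sum_mono sum_le)
  finally have s: "(\<Sum>c\<in>C. s c) \<le> card C * m"
    using \<open>card C > 0\<close> by (simp add: m_def)
  \<comment> \<open>Jensen via the tangent at \<open>m\<close>: first the nonnegative slack
    \<open>card C * m - (\<Sum>c\<in>C. s c)\<close> is added, then each tangent value is bounded by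
    the exponential through \<open>1 + y \<le> exp y\<close>.\<close>
  have "card C * exp (- 2 * m)
      \<le> exp (- 2 * m) * (card C + 2 * (card C * m - (\<Sum>c\<in>C. s c)))"
    using s by (simp add: algebra_simps)
  also have "\<dots> = (\<Sum>c\<in>C. exp (- 2 * m) * (1 + (- 2 * s c - - 2 * m)))"
    by (simp add: sum.distrib sum_subtractf algebra_simps flip: sum_distrib_left sum_distrib_right)
  also have "\<dots> \<le> (\<Sum>c\<in>C. exp (- 2 * m) * exp (- 2 * s c - - 2 * m))"
    by (intro sum_mono mult_left_mono exp_ge_add_one_self) auto
  also have "\<dots> = (\<Sum>c\<in>C. exp (- 2 * s c))"
    by (simp flip: exp_add)
  also have "\<dots> = (\<Sum>c\<in>C. \<Prod>u\<in>U. exp (- 2 * x u c))"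
    using \<open>finite U\<close> by (simp add: s_def sum_distrib_left exp_sum flip: sum_negf)
  also have "\<dots> \<le> (\<Sum>c\<in>C. \<Prod>u\<in>U. 1 - x u c)"
    by (intro sum_mono prod_mono) (use exp_minus_double_le_one_minus x in auto)
  finally show ?thesis
    by (simp add: m_def)
qed

section \<open>Finitely supported distributions and measurability of histories\<close>

lemma prob_pmf_Compl_singleton: "measure_pmf.prob p (- {c}) = 1 - pmf p c"
  using measure_pmf.prob_compl[of "{c}" p] by (simp add: Compl_eq_Diff_UNIV measure_pmf_single)

lemma prob_pmf_eq_sum:
  assumes "finite (set_pmf p)"
  shows "measure_pmf.prob p A = (\<Sum>x\<in>set_pmf p. pmf p x * indicator A x)"
proof -
  have "measure_pmf.prob p A = measure_pmf.prob p (A \<inter> set_pmf p)"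
    by (simp add: measure_Int_set_pmf)
  also have "\<dots> = (\<Sum>x\<in>set_pmf p \<inter> A. pmf p x)"
    using assms by (simp add: measure_measure_pmf_finite Int_commute)
  also have "\<dots> = (\<Sum>x\<in>set_pmf p. pmf p x * indicator A x)"
    using assms by (simp add: sum.inter_restrict indicator_def)
  finally show ?thesis .
qed

lemma prob_bind_pmf_eq_sum:
  assumes "finite (set_pmf p)"
  shows "measure_pmf.prob (bind_pmf p f) A = (\<Sum>x\<in>set_pmf p. pmf p x * measure_pmf.prob (f x) A)"
proof -
  have "ennreal (measure_pmf.prob (bind_pmf p f) A)
      = (\<integral>\<^sup>+x. measure_pmf.prob (f x) A \<partial>measure_pmf p)"
    by (simp flip: measure_pmf.emeasure_eq_measure)
  also have "\<dots> = ennreal (\<Sum>x\<in>set_pmf p. pmf p x * measure_pmf.prob (f x) A)"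
    using assms by (simp add: nn_integral_measure_pmf_finite sum_ennreal mult.commute flip: ennreal_mult)
  finally show ?thesis
    by (simp add: sum_nonneg)
qed

lemma sets_Collect_count_space:
  assumes "f \<in> M \<rightarrow>\<^sub>M count_space UNIV"
  shows "{\<omega> \<in> space M. P (f \<omega>)} \<in> sets M"
proof -
  have "{\<omega> \<in> space M. P (f \<omega>)} = f -` {x. P x} \<inter> space M"
    by auto
  then show ?thesis
    using measurable_sets[OF assms, of "{x. P x}"] by simp
qed

lemma sets_Collect_history:
  fixes t :: nat
  assumes "\<And>s. L s \<in> M \<rightarrow>\<^sub>M count_space UNIV"
  shows "{\<omega> \<in> space M. \<forall>s\<le>t. P s (L s \<omega>)} \<in> sets M"
  by (intro sets.sets_Collect_countable_All sets.sets_Collect_imp sets.sets_Collect_const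
      sets_Collect_count_space assms)

text \<open>
  With \<open>d = exp (- 2) / 2\<close>, the expected fraction of reusable colors that are free after one round
  is at least \<open>2 * d\<close>, hence the fraction exceeds \<open>d\<close> with probability at least \<open>d\<close>; the other factor
  is the success probability in the following round.
\<close>

definition recovery_prob :: real where
  "recovery_prob = exp (- 2) / 2 * exp (- 2 / (exp (- 2) / 2))"

lemma recovery_prob_bounds: "0 < recovery_prob" "recovery_prob < 1"
proof -
  show "0 < recovery_prob"
    by (simp add: recovery_prob_def)
  have "exp (- 2 :: real) < 2"
    by (rule less_trans[of _ 1]) simp_all
  then have "recovery_prob < 1 * 1"
    unfolding recovery_prob_def
    by (intro mult_strict_mono) simp_all
  then show "recovery_prob < 1"
    by simp
qed

section \<open>Free colors and the persistence of happiness\<close>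

locale greedy_coloring =
  fixes n q :: nat and E :: "nat rel"
  assumes graph: "simple_graph n E"
    and degree: "\<And>i. i \<in> {1..n} \<Longrightarrow> card (neighbours E i) + 2 \<le> q"
begin

abbreviation step :: "(nat \<Rightarrow> nat) \<Rightarrow> (nat \<Rightarrow> nat) pmf" where
  "step \<equiv> next_state n q E"

definition happy :: "(nat \<Rightarrow> nat) \<Rightarrow> nat \<Rightarrow> bool" where
  "happy l i \<longleftrightarrow> (\<forall>j\<in>neighbours E i. l i \<noteq> l j)"

definition free_colors :: "(nat \<Rightarrow> nat) \<Rightarrow> nat \<Rightarrow> nat set" where
  "free_colors l i = {1..q} - l ` neighbours E i"

definition unhappy_neighbours :: "(nat \<Rightarrow> nat) \<Rightarrow> nat \<Rightarrow> nat set" where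
  "unhappy_neighbours l i = {j \<in> neighbours E i. \<not> happy l j}"

lemma payoff_eq_1_iff: "payoff E l i = 1 \<longleftrightarrow> happy l i"
  by (simp add: payoff_def happy_def)

lemma neighbours_subset: "neighbours E i \<subseteq> {1..n}"
  using graph by (auto simp: simple_graph_def neighbours_def)

lemma neighbour_player: "j \<in> neighbours E i \<Longrightarrow> j \<in> {1..n}"
  using neighbours_subset by blast

lemma finite_neighbours [simp]: "finite (neighbours E i)"
  using neighbours_subset finite_subset by blast

lemma neighbours_sym: "j \<in> neighbours E i \<Longrightarrow> i \<in> neighbours E j"
  using graph by (auto simp: simple_graph_def neighbours_def sym_def)

lemma not_neighbour_self: "i \<notin> neighbours E i"
  using graph by (auto simp: simple_graph_def neighbours_def irrefl_def)

lemma finite_free_colors [simp]: "finite (free_colors l i)"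
  by (simp add: free_colors_def)

text \<open>The two spare colors enter here. They cap the probability of each choice of an unhappy
  player at 1/2, the range in which \<open>1 - x \<ge> exp (- 2 * x)\<close> is available.\<close>

lemma card_free_colors:
  assumes "i \<in> {1..n}"
  shows "2 \<le> card (free_colors l i)"
proof -
  have "card (l ` neighbours E i) \<le> card (neighbours E i)"
    by (simp add: card_image_le)
  moreover have "q - card (l ` neighbours E i) \<le> card (free_colors l i)"
    using diff_card_le_card_Diff[of "l ` neighbours E i" "{1..q}"]
    by (simp add: free_colors_def)
  ultimately show ?thesis
    using degree[OF assms] by linarith
qed

lemma free_colors_nonempty:
  assumes "i \<in> {1..n}"
  shows "free_colors l i \<noteq> {}"
  using card_free_colors[OF assms, of l] by auto

lemma next_color_eq:
  "next_color q E l i = (if happy l i then return_pmf (l i) else pmf_of_set (free_colors l i))"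
  unfolding next_color_def payoff_eq_1_iff free_colors_def ..

lemma pmf_next_color_unhappy:
  assumes "i \<in> {1..n}" "\<not> happy l i"
  shows "pmf (next_color q E l i) c = indicator (free_colors l i) c / card (free_colors l i)"
  using assms free_colors_nonempty[OF assms(1), of l] by (simp add: next_color_eq pmf_of_set)

lemma finite_set_pmf_next_color:
  assumes "i \<in> {1..n}"
  shows "finite (set_pmf (next_color q E l i))"
  using free_colors_nonempty[OF assms] by (simp add: next_color_eq)

lemma finite_set_pmf_step [simp]: "finite (set_pmf (step l))"
  unfolding next_state_def
  by (subst set_Pi_pmf) (auto intro!: finite_PiE_dflt finite_set_pmf_next_color)

lemma step_next_color:
  assumes "l' \<in> set_pmf (step l)" "i \<in> {1..n}"
  shows "happy l i \<Longrightarrow> l' i = l i" "\<not> happy l i \<Longrightarrow> l' i \<in> free_colors l i"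
proof -
  have "l' i \<in> set_pmf (next_color q E l i)"
    using assms by (auto simp: next_state_def set_Pi_pmf PiE_dflt_def)
  then show "happy l i \<Longrightarrow> l' i = l i" "\<not> happy l i \<Longrightarrow> l' i \<in> free_colors l i"
    using free_colors_nonempty[OF assms(2), of l] by (auto simp: next_color_eq)
qed

text \<open>A happy player keeps its color, and so do its happy neighbours. An unhappy neighbour
  avoids every color used around it, in particular that of the happy player.\<close>

lemma happy_step:
  assumes "l' \<in> set_pmf (step l)" "i \<in> {1..n}" "happy l i"
  shows "happy l' i"
  unfolding happy_def
proof
  fix j assume j: "j \<in> neighbours E i"
  then have "j \<in> {1..n}"
    by (rule neighbour_player)
  moreover have "l i \<notin> free_colors l j"
    using neighbours_sym[OF j] by (auto simp: free_colors_def)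
  ultimately have "l' j \<noteq> l i"
    using step_next_color[OF assms(1), of j] assms(3) j by (cases "happy l j") (auto simp: happy_def)
  then show "l' i \<noteq> l' j"
    using step_next_color(1)[OF assms] by simp
qed

lemma unhappy_neighbours_step:
  assumes "l' \<in> set_pmf (step l)"
  shows "unhappy_neighbours l' i \<subseteq> unhappy_neighbours l i"
  using happy_step[OF assms] neighbour_player unfolding unhappy_neighbours_def by blast

section \<open>Success within one and two rounds\<close>

lemma prob_color_avoided:
  "measure_pmf.prob (step l) {l'. c \<notin> l' ` neighbours E i}
     = (\<Prod>u\<in>neighbours E i. 1 - pmf (next_color q E l u) c)"
proof -
  \<comment> \<open>The event restricts each coordinate separately, so the product distribution
    factors over it; players other than the neighbours contribute 1.\<close>
  let ?B = "\<lambda>u. if u \<in> neighbours E i then - {c} else UNIV"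
  have "{l'. c \<notin> l' ` neighbours E i} = Pi {1..n} ?B"
    using neighbours_subset by (force simp: Pi_def)
  then have "measure_pmf.prob (step l) {l'. c \<notin> l' ` neighbours E i}
      = (\<Prod>u\<in>{1..n}. measure_pmf.prob (next_color q E l u) (?B u))"
    by (simp add: next_state_def measure_Pi_pmf_Pi)
  also have "\<dots> = (\<Prod>u\<in>neighbours E i. measure_pmf.prob (next_color q E l u) (- {c}))"
    by (rule prod.mono_neutral_cong_right) (use neighbours_subset in auto)
  also have "\<dots> = (\<Prod>u\<in>neighbours E i. 1 - pmf (next_color q E l u) c)"
    by (simp add: prob_pmf_Compl_singleton)
  finally show ?thesis .
qed

lemma prob_color_chosen_and_avoided:
  assumes "i \<in> {1..n}"
  shows "measure_pmf.prob (step l) {l'. l' i = c \<and> c \<notin> l' ` neighbours E i}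
     = pmf (next_color q E l i) c * (\<Prod>u\<in>neighbours E i. 1 - pmf (next_color q E l u) c)"
proof -
  let ?B = "\<lambda>u. if u = i then {c} else if u \<in> neighbours E i then - {c} else UNIV"
  have "{l'. l' i = c \<and> c \<notin> l' ` neighbours E i} = Pi {1..n} ?B"
  proof (intro set_eqI iffI)
    fix l' assume "l' \<in> {l'. l' i = c \<and> c \<notin> l' ` neighbours E i}"
    then have "l' i = c" "\<And>u. u \<in> neighbours E i \<Longrightarrow> l' u \<noteq> c"
      by blast+
    then show "l' \<in> Pi {1..n} ?B"
      by simp
  next
    fix l' assume l': "l' \<in> Pi {1..n} ?B"
    have "l' j \<noteq> c" if "j \<in> neighbours E i" for j
      using Pi_mem[OF l' neighbour_player[OF that]] that not_neighbour_self
      by (auto split: if_splits)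
    moreover have "l' i = c"
      using Pi_mem[OF l' assms] by simp
    ultimately show "l' \<in> {l'. l' i = c \<and> c \<notin> l' ` neighbours E i}"
      by blast
  qed
  then have "measure_pmf.prob (step l) {l'. l' i = c \<and> c \<notin> l' ` neighbours E i}
      = (\<Prod>u\<in>{1..n}. measure_pmf.prob (next_color q E l u) (?B u))"
    by (simp add: next_state_def measure_Pi_pmf_Pi)
  also have "\<dots> = (\<Prod>u\<in>insert i (neighbours E i). measure_pmf.prob (next_color q E l u) (?B u))"
    by (rule prod.mono_neutral_right) (use neighbours_subset assms in auto)
  also have "\<dots> = pmf (next_color q E l i) c *
      (\<Prod>u\<in>neighbours E i. measure_pmf.prob (next_color q E l u) (?B u))"
    using not_neighbour_self by (simp add: measure_pmf_single)
  also have "(\<Prod>u\<in>neighbours E i. measure_pmf.prob (next_color q E l u) (?B u))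
      = (\<Prod>u\<in>neighbours E i. 1 - pmf (next_color q E l u) c)"
    by (rule prod.cong)
      (use not_neighbour_self in \<open>auto simp: prob_pmf_Compl_singleton\<close>)
  finally show ?thesis .
qed

text \<open>Happy neighbours repeat colors outside \<open>C\<close>, so their factors are 1 and only
  unhappy neighbours matter. The set \<open>C\<close> is left general because it is the set of free
  colors in the one-round bound and a larger set of reusable colors in the two-round bound.\<close>

lemma sum_prob_color_avoided_ge:
  assumes "finite C" "C \<noteq> {}"
    and C: "\<And>j. j \<in> neighbours E i \<Longrightarrow> happy l j \<Longrightarrow> l j \<notin> C"
  shows "card C * exp (- 2 * (card (unhappy_neighbours l i) / card C))
     \<le> (\<Sum>c\<in>C. \<Prod>u\<in>neighbours E i. 1 - pmf (next_color q E l u) c)"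
proof -
  have "(\<Prod>u\<in>neighbours E i. 1 - pmf (next_color q E l u) c)
      = (\<Prod>u\<in>unhappy_neighbours l i. 1 - pmf (next_color q E l u) c)" if "c \<in> C" for c
  proof (rule prod.mono_neutral_right)
    show "\<forall>u\<in>neighbours E i - unhappy_neighbours l i. 1 - pmf (next_color q E l u) c = 1"
    proof
      fix u assume "u \<in> neighbours E i - unhappy_neighbours l i"
      then have "happy l u" "l u \<noteq> c"
        using C that by (auto simp: unhappy_neighbours_def)
      then show "1 - pmf (next_color q E l u) c = 1"
        by (simp add: next_color_eq)
    qed
  qed (auto simp: unhappy_neighbours_def)
  then have "(\<Sum>c\<in>C. \<Prod>u\<in>neighbours E i. 1 - pmf (next_color q E l u) c)
      = (\<Sum>c\<in>C. \<Prod>u\<in>unhappy_neighbours l i. 1 - pmf (next_color q E l u) c)"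
    by simp
  moreover have "card C * exp (- 2 * (card (unhappy_neighbours l i) / card C))
      \<le> (\<Sum>c\<in>C. \<Prod>u\<in>unhappy_neighbours l i. 1 - pmf (next_color q E l u) c)"
  proof (rule sum_prod_one_minus_ge[OF assms(1,2)])
    show "finite (unhappy_neighbours l i)"
      by (simp add: unhappy_neighbours_def)
    show "0 \<le> pmf (next_color q E l u) c \<and> pmf (next_color q E l u) c \<le> 1 / 2"
      if "u \<in> unhappy_neighbours l i" "c \<in> C" for u c
    proof -
      have u: "u \<in> {1..n}" "\<not> happy l u"
        using that neighbour_player unfolding unhappy_neighbours_def by blast+
      have "pmf (next_color q E l u) c \<le> 1 / card (free_colors l u)"
        by (subst pmf_next_color_unhappy[OF u]) (auto simp: indicator_def)
      also have "\<dots> \<le> 1 / 2"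
        using card_free_colors[OF u(1), of l] by (intro divide_left_mono) auto
      finally show ?thesis
        by simp
    qed
    show "(\<Sum>c\<in>C. pmf (next_color q E l u) c) \<le> 1" for u
      using measure_pmf.prob_le_1[of "next_color q E l u" C] \<open>finite C\<close>
      by (simp add: measure_measure_pmf_finite)
  qed
  ultimately show ?thesis
    by simp
qed

text \<open>The color of \<open>i\<close> is uniform on its free colors and independent of the
  choices of its neighbours. Hence the success probability is at least the average, over the free
  colors, of the probability that all neighbours avoid the color.\<close>

lemma prob_happy_step_ge:
  assumes "i \<in> {1..n}" "\<not> happy l i"
  shows "exp (- 2 * (card (unhappy_neighbours l i) / card (free_colors l i)))
     \<le> measure_pmf.prob (step l) {l'. happy l' i}"
proof -
  let ?A = "free_colors l i"
  let ?P = "\<lambda>c. \<Prod>u\<in>neighbours E i. 1 - pmf (next_color q E l u) c"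
  have A: "real (card ?A) > 0"
    using card_free_colors[OF assms(1), of l] by simp
  have "card ?A * exp (- 2 * (card (unhappy_neighbours l i) / card ?A)) \<le> (\<Sum>c\<in>?A. ?P c)"
    by (rule sum_prob_color_avoided_ge)
      (use free_colors_nonempty[OF assms(1)] in \<open>auto simp: free_colors_def\<close>)
  then have "exp (- 2 * (card (unhappy_neighbours l i) / card ?A)) \<le> (\<Sum>c\<in>?A. ?P c) / card ?A"
    using A by (simp add: pos_le_divide_eq mult.commute)
  also have "\<dots> = (\<Sum>c\<in>?A. measure_pmf.prob (step l) {l'. l' i = c \<and> c \<notin> l' ` neighbours E i})"
    unfolding prob_color_chosen_and_avoided[OF assms(1)]
    by (simp add: pmf_next_color_unhappy[OF assms] sum_divide_distrib)
  also have "\<dots> = measure_pmf.prob (step l)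
      (\<Union>c\<in>?A. {l'. l' i = c \<and> c \<notin> l' ` neighbours E i})"
    by (rule measure_pmf.finite_measure_finite_Union[symmetric])
      (auto simp: disjoint_family_on_def)
  also have "\<dots> \<le> measure_pmf.prob (step l) {l'. happy l' i}"
    by (rule measure_pmf.finite_measure_mono) (auto simp: happy_def)
  finally show ?thesis .
qed

lemma prob_happy_step_of_happy:
  assumes "i \<in> {1..n}" "happy l i"
  shows "measure_pmf.prob (step l) {l'. happy l' i} = 1"
  using happy_step[OF _ assms] by (subst measure_pmf.prob_eq_1) (auto simp: AE_measure_pmf_iff)

text \<open>
  The colors in \<open>B\<close> are those that no happy neighbour of \<open>i\<close> blocks for good. There are at least as
  many of them as unhappy neighbours of \<open>i\<close>, so in expectation a constant fraction of \<open>B\<close> is free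
  for \<open>i\<close> after one round; whenever this is the case, \<open>i\<close> succeeds in the round
  after that with constant probability.
\<close>

lemma prob_happy_two_steps_ge:
  assumes "i \<in> {1..n}"
  shows "recovery_prob \<le> measure_pmf.prob (bind_pmf (step l) step) {l'. happy l' i}"
proof -
  define d :: real where "d = exp (- 2) / 2"
  have "d > 0"
    by (simp add: d_def)
  define H where "H = neighbours E i - unhappy_neighbours l i"
  define B where "B = {1..q} - l ` H"
  have [simp]: "finite B" "finite (unhappy_neighbours l i)"
    by (simp_all add: B_def unhappy_neighbours_def)
  \<comment> \<open>Happy neighbours block at most \<open>card H\<close> of the \<open>q\<close>
    colors, and \<open>q\<close> exceeds the degree by at least 2; what remains covers the unhappy
    neighbours.\<close>
  have "card H + card (unhappy_neighbours l i) = card (neighbours E i)"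
    unfolding H_def by (subst card_Diff_subset) (auto simp: unhappy_neighbours_def card_mono)
  moreover have "card (l ` H) \<le> card H"
    by (simp add: H_def card_image_le)
  moreover have "q - card (l ` H) \<le> card B"
    using diff_card_le_card_Diff[of "l ` H" "{1..q}"] by (simp add: B_def H_def)
  ultimately have card_B: "card (unhappy_neighbours l i) \<le> card B" "card B > 0"
    using degree[OF assms] by linarith+
  then have "B \<noteq> {}"
    by auto
  define y where "y l' = card (B - l' ` neighbours E i) / card B" for l'

  \<comment> \<open>A bound linear in \<open>y l'\<close> can be averaged directly, without
    splitting off the event that \<open>y l'\<close> is large: for \<open>y l' < d\<close> the left
    side is negative, and otherwise \<open>y l' - d \<le> 1\<close>.\<close>
  have y_le: "exp (- 2 / d) * (y l' - d) \<le> measure_pmf.prob (step l') {l''. happy l'' i}"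
    if l': "l' \<in> set_pmf (step l)" for l'
  proof (cases "y l' < d")
    case True
    then have "exp (- 2 / d) * (y l' - d) \<le> 0"
      by (simp add: mult_le_0_iff)
    then show ?thesis
      using measure_nonneg order_trans by blast
  next
    case False
    have "y l' \<le> 1"
      using card_B card_mono[of B "B - l' ` neighbours E i"] by (simp add: y_def)
    then have le: "exp (- 2 / d) * (y l' - d) \<le> exp (- 2 / d) * 1"
      using \<open>d > 0\<close> by (intro mult_left_mono) auto
    show ?thesis
    proof (cases "happy l' i")
      case True
      have "exp (- 2 / d) * 1 \<le> 1"
        using \<open>d > 0\<close> by simp
      from order_trans[OF le this] show ?thesis
        using prob_happy_step_of_happy[OF assms True] by simp
    next
      case unhappy: False
      have "exp (- 2 / d) * (y l' - d) \<le> exp (- 2 / d) * 1"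
        by (rule le)
      also have "\<dots> \<le> exp (- 2 * (card (unhappy_neighbours l' i) / card (free_colors l' i)))"
      proof -
        \<comment> \<open>The number of unhappy neighbours cannot grow, so the bound by
          \<open>card B\<close> survives the first round, while at least \<open>d * card B\<close>
          colors of \<open>B\<close> are free after it.\<close>
        have "card (unhappy_neighbours l' i) \<le> card B"
          using card_mono[OF _ unhappy_neighbours_step[OF l', of i]] card_B(1) by simp
        then have "d * card (unhappy_neighbours l' i) \<le> d * card B"
          using \<open>d > 0\<close> by simp
        also have "\<dots> \<le> y l' * card B"
          using False by (intro mult_right_mono) auto
        also have "\<dots> = card (B - l' ` neighbours E i)"
          using card_B by (simp add: y_def)
        also have "\<dots> \<le> card (free_colors l' i)"
          by (auto intro!: card_mono simp: free_colors_def B_def)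
        finally have "d * card (unhappy_neighbours l' i) \<le> card (free_colors l' i)" .
        then have "card (unhappy_neighbours l' i) / card (free_colors l' i) \<le> 1 / d"
          using \<open>d > 0\<close> card_free_colors[OF assms, of l'] by (simp add: field_simps)
        then show ?thesis
          by simp
      qed
      also have "\<dots> \<le> measure_pmf.prob (step l') {l''. happy l'' i}"
        using prob_happy_step_ge[OF assms unhappy] .
      finally show ?thesis .
    qed
  qed

  \<comment> \<open>Double counting of pairs of a color in \<open>B\<close> and a successor state
    leaving it free: the mean of \<open>y\<close> is at least \<open>2 * d\<close>.\<close>
  have "2 * d * card B = card B * exp (- 2 * 1)"
    by (simp add: d_def)
  also have "\<dots> \<le> card B * exp (- 2 * (card (unhappy_neighbours l i) / card B))"
    using card_B by (intro mult_left_mono) (auto simp: field_simps)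
  also have "\<dots> \<le> (\<Sum>c\<in>B. \<Prod>u\<in>neighbours E i. 1 - pmf (next_color q E l u) c)"
    by (rule sum_prob_color_avoided_ge)
      (use \<open>B \<noteq> {}\<close> in \<open>auto simp: B_def H_def unhappy_neighbours_def\<close>)
  also have "\<dots> = (\<Sum>c\<in>B. measure_pmf.prob (step l) {l'. c \<notin> l' ` neighbours E i})"
    by (simp add: prob_color_avoided)
  also have "\<dots> = (\<Sum>c\<in>B. \<Sum>l'\<in>set_pmf (step l).
      pmf (step l) l' * indicator {l'. c \<notin> l' ` neighbours E i} l')"
    by (simp add: prob_pmf_eq_sum)
  also have "\<dots> = (\<Sum>l'\<in>set_pmf (step l). \<Sum>c\<in>B.
      pmf (step l) l' * indicator {l'. c \<notin> l' ` neighbours E i} l')"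
    by (rule sum.swap)
  also have "\<dots> = (\<Sum>l'\<in>set_pmf (step l). pmf (step l) l' * card (B - l' ` neighbours E i))"
  proof (intro sum.cong refl)
    fix l'
    have "B - l' ` neighbours E i = {c \<in> B. c \<notin> l' ` neighbours E i}"
      by auto
    then show "(\<Sum>c\<in>B. pmf (step l) l' * indicator {l'. c \<notin> l' ` neighbours E i} l')
        = pmf (step l) l' * card (B - l' ` neighbours E i)"
      by (simp add: indicator_def sum.If_cases Int_def flip: sum_distrib_left)
  qed
  also have "\<dots> = (\<Sum>l'\<in>set_pmf (step l). pmf (step l) l' * y l') * card B"
    using \<open>B \<noteq> {}\<close> by (simp add: y_def sum_distrib_right)
  finally have y: "2 * d \<le> (\<Sum>l'\<in>set_pmf (step l). pmf (step l) l' * y l')"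
    using card_B by simp

  have "recovery_prob = exp (- 2 / d) * (2 * d - d)"
    by (simp add: recovery_prob_def d_def)
  also have "\<dots> \<le> exp (- 2 / d) * ((\<Sum>l'\<in>set_pmf (step l). pmf (step l) l' * y l') - d)"
    using y by (intro mult_left_mono) auto
  also have "\<dots> = exp (- 2 / d) * ((\<Sum>l'\<in>set_pmf (step l). pmf (step l) l' * y l')
      - d * (\<Sum>l'\<in>set_pmf (step l). pmf (step l) l'))"
    by (simp add: sum_pmf_eq_1)
  also have "\<dots> = (\<Sum>l'\<in>set_pmf (step l). pmf (step l) l' * (exp (- 2 / d) * (y l' - d)))"
    unfolding sum_distrib_left sum_subtractf[symmetric] by (simp add: algebra_simps)
  also have "\<dots> \<le> (\<Sum>l'\<in>set_pmf (step l).
      pmf (step l) l' * measure_pmf.prob (step l') {l''. happy l'' i})"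
    by (intro sum_mono mult_left_mono y_le) auto
  also have "\<dots> = measure_pmf.prob (bind_pmf (step l) step) {l'. happy l' i}"
    by (simp add: prob_bind_pmf_eq_sum)
  finally show ?thesis .
qed

section \<open>Geometric decay over many rounds and passage to the play\<close>

primrec run :: "nat \<Rightarrow> (nat \<Rightarrow> nat) \<Rightarrow> (nat \<Rightarrow> nat) pmf" where
  "run 0 l = return_pmf l"
| "run (Suc k) l = bind_pmf (step l) (run k)"

lemma happy_run:
  assumes "i \<in> {1..n}" "happy l i" "l' \<in> set_pmf (run k l)"
  shows "happy l' i"
  using assms(2,3) by (induction k arbitrary: l) (auto dest: happy_step[OF _ assms(1)])

text \<open>Two rounds are peeled off at a time. A player happy after them stays happy and
  contributes nothing; otherwise the induction hypothesis applies from the state reached, as the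
  two-round bound is uniform in the starting state.\<close>

lemma prob_unhappy_run_le:
  assumes "i \<in> {1..n}"
  shows "measure_pmf.prob (run (2 * t) l) {l'. \<not> happy l' i} \<le> (1 - recovery_prob) ^ t"
proof (induction t arbitrary: l)
  case (Suc t)
  let ?U = "{l'. \<not> happy l' i}"
  let ?two = "bind_pmf (step l) step"
  have fin: "finite (set_pmf ?two)"
    by simp
  have "run (2 * Suc t) l = bind_pmf ?two (run (2 * t))"
    by (auto simp: bind_assoc_pmf intro!: bind_pmf_cong)
  then have "measure_pmf.prob (run (2 * Suc t) l) ?U
      = (\<Sum>l'\<in>set_pmf ?two. pmf ?two l' * measure_pmf.prob (run (2 * t) l') ?U)"
    using prob_bind_pmf_eq_sum[OF fin] by simp
  also have "\<dots> \<le> (\<Sum>l'\<in>set_pmf ?two. pmf ?two l' * (indicator ?U l' * (1 - recovery_prob) ^ t))"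
  proof (intro sum_mono mult_left_mono)
    fix l'
    show "measure_pmf.prob (run (2 * t) l') ?U \<le> indicator ?U l' * (1 - recovery_prob) ^ t"
    proof (cases "happy l' i")
      case True
      then have "measure_pmf.prob (run (2 * t) l') ?U = 0"
        using happy_run[OF assms] by (auto simp: measure_pmf_zero_iff)
      then show ?thesis
        using True by simp
    qed (use Suc in simp)
  qed simp
  also have "\<dots> = measure_pmf.prob ?two ?U * (1 - recovery_prob) ^ t"
    unfolding prob_pmf_eq_sum[OF fin] sum_distrib_right by (simp add: mult.assoc)
  also have "measure_pmf.prob ?two ?U = 1 - measure_pmf.prob ?two {l'. happy l' i}"
    using measure_pmf.prob_compl[of "{l'. happy l' i}" ?two]
    by (simp add: Compl_eq_Diff_UNIV[symmetric] Collect_neg_eq)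
  also have "\<dots> * (1 - recovery_prob) ^ t \<le> (1 - recovery_prob) * (1 - recovery_prob) ^ t"
    using prob_happy_two_steps_ge[OF assms, of l] recovery_prob_bounds
    by (intro mult_right_mono) auto
  finally show ?case
    by simp
qed simp

lemma prob_conflict_run_le:
  "measure_pmf.prob (run (2 * t) l) {l'. \<exists>i\<in>{1..n}. \<not> happy l' i} \<le> n * (1 - recovery_prob) ^ t"
proof -
  have "{l'. \<exists>i\<in>{1..n}. \<not> happy l' i} = (\<Union>i\<in>{1..n}. {l'. \<not> happy l' i})"
    by auto
  then have "measure_pmf.prob (run (2 * t) l) {l'. \<exists>i\<in>{1..n}. \<not> happy l' i}
      \<le> (\<Sum>i\<in>{1..n}. measure_pmf.prob (run (2 * t) l) {l'. \<not> happy l' i})"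
    by (simp add: measure_pmf.finite_measure_subadditive_finite)
  also have "\<dots> \<le> (\<Sum>i\<in>{1..n}. (1 - recovery_prob) ^ t)"
    by (intro sum_mono prob_unhappy_run_le)
  finally show ?thesis
    by simp
qed

text \<open>
  Fixing the whole history up to time \<open>t\<close> lets the induction on \<open>k\<close> use the defining property of the
  game directly.
\<close>

lemma prob_history_run_le:
  assumes game: "greedy_selfish_game M n q E l0 L"
  shows "\<P>(\<omega> in M. (\<forall>s\<le>t. L s \<omega> = h s) \<and> L (t + k) \<omega> \<in> A)
    \<le> \<P>(\<omega> in M. \<forall>s\<le>t. L s \<omega> = h s) * measure_pmf.prob (run k (h t)) A"
proof (induction k arbitrary: t h)
  case 0
  interpret prob_space M
    using game by (simp add: greedy_selfish_game_def)
  have "{\<omega> \<in> space M. (\<forall>s\<le>t. L s \<omega> = h s) \<and> L (t + 0) \<omega> \<in> A}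
      = (if h t \<in> A then {\<omega> \<in> space M. \<forall>s\<le>t. L s \<omega> = h s} else {})"
    by auto
  then show ?case
    by (auto simp: measure_return_pmf)
next
  case (Suc k)
  interpret prob_space M
    using game by (simp add: greedy_selfish_game_def)
  have L: "L t \<in> M \<rightarrow>\<^sub>M count_space UNIV" for t
    using game by (simp add: greedy_selfish_game_def)
  let ?p = "step (h t)"
  \<comment> \<open>\<open>H\<close> fixes the history up to \<open>t\<close>, \<open>G x\<close>
    extends it by the state \<open>x\<close>, and \<open>G' x\<close> adds the target event, so the
    induction hypothesis at time \<open>Suc t\<close> applies to \<open>G' x\<close>.\<close>
  define H where "H = {\<omega> \<in> space M. \<forall>s\<le>t. L s \<omega> = h s}"
  define G where "G x = {\<omega> \<in> space M. \<forall>s\<le>Suc t. L s \<omega> = (h(Suc t := x)) s}" for x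
  define G' where "G' x = {\<omega> \<in> G x. L (Suc t + k) \<omega> \<in> A}" for x
  have G_eq: "G x = {\<omega> \<in> H. L (Suc t) \<omega> = x}" for x
    by (auto simp: G_def H_def le_Suc_eq)
  have [simp]: "H \<in> sets M" "G x \<in> sets M" for x
    unfolding H_def G_def
    using sets_Collect_history[where L = L and P = "\<lambda>s l. l = h s", OF L]
      sets_Collect_history[where L = L and P = "\<lambda>s l. l = (h(Suc t := x)) s", OF L]
    by blast+
  have "G' x = G x \<inter> {\<omega> \<in> space M. L (Suc t + k) \<omega> \<in> A}" for x
    by (auto simp: G'_def G_def)
  then have [simp]: "G' x \<in> sets M" for x
    using sets_Collect_count_space[OF L[of "Suc t + k"], of "\<lambda>l. l \<in> A"] by (simp add: sets.Int)
  have [simp]: "(\<Union>x\<in>set_pmf ?p. G x) \<in> sets M" "(\<Union>x\<in>set_pmf ?p. G' x) \<in> sets M"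
    by (intro sets.finite_UN; simp)+
  have prob_G: "prob (G x) = prob H * pmf ?p x" for x
  proof -
    have "prob (G x) = \<P>(\<omega> in M. \<forall>s\<le>t. L s \<omega> = (h(Suc t := x)) s) *
        pmf (next_state n q E ((h(Suc t := x)) t)) ((h(Suc t := x)) (Suc t))"
      using game unfolding greedy_selfish_game_def G_def by blast
    moreover have "{\<omega> \<in> space M. \<forall>s\<le>t. L s \<omega> = (h(Suc t := x)) s} = H"
      by (auto simp: H_def)
    ultimately show ?thesis
      by simp
  qed
  have IH: "prob (G' x) \<le> prob H * (pmf ?p x * measure_pmf.prob (run k x) A)" for x
  proof -
    have "G' x = {\<omega> \<in> space M.
        (\<forall>s\<le>Suc t. L s \<omega> = (h(Suc t := x)) s) \<and> L (Suc t + k) \<omega> \<in> A}"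
      by (auto simp: G'_def G_def)
    then have "prob (G' x) \<le> prob (G x) * measure_pmf.prob (run k x) A"
      using Suc[of "Suc t" "h(Suc t := x)"] unfolding G_def by simp
    then show ?thesis
      by (simp add: prob_G mult.assoc)
  qed
  \<comment> \<open>The game condition speaks of one successor at a time, but the type of states is
    uncountable. The successors outside the support are therefore discarded together: the finitely
    many \<open>G x\<close> in the support already carry the whole mass of \<open>H\<close>.\<close>
  have "prob (H - (\<Union>x\<in>set_pmf ?p. G x)) = prob H - prob (\<Union>x\<in>set_pmf ?p. G x)"
    by (rule finite_measure_Diff) (simp_all, auto simp: G_eq)
  also have "prob (\<Union>x\<in>set_pmf ?p. G x) = (\<Sum>x\<in>set_pmf ?p. prob (G x))"
    by (rule finite_measure_finite_Union)
      (simp_all add: image_subset_iff, auto simp: disjoint_family_on_def G_eq)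
  also have "\<dots> = prob H"
    unfolding prob_G by (simp add: sum_pmf_eq_1 flip: sum_distrib_left)
  finally have null: "prob (H - (\<Union>x\<in>set_pmf ?p. G x)) = 0"
    by simp
  have "{\<omega> \<in> space M. (\<forall>s\<le>t. L s \<omega> = h s) \<and> L (t + Suc k) \<omega> \<in> A}
      \<subseteq> (\<Union>x\<in>set_pmf ?p. G' x) \<union> (H - (\<Union>x\<in>set_pmf ?p. G x))"
    by (auto simp: G'_def G_eq H_def)
  then have "\<P>(\<omega> in M. (\<forall>s\<le>t. L s \<omega> = h s) \<and> L (t + Suc k) \<omega> \<in> A)
      \<le> prob ((\<Union>x\<in>set_pmf ?p. G' x) \<union> (H - (\<Union>x\<in>set_pmf ?p. G x)))"
    by (rule finite_measure_mono) (simp add: sets.Un sets.Diff)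
  also have "\<dots> \<le> prob (\<Union>x\<in>set_pmf ?p. G' x) + prob (H - (\<Union>x\<in>set_pmf ?p. G x))"
    by (rule measure_Un_le) (simp_all add: sets.Diff)
  also have "\<dots> \<le> (\<Sum>x\<in>set_pmf ?p. prob (G' x))"
    unfolding null by (simp add: finite_measure_subadditive_finite image_subset_iff)
  also have "\<dots> \<le> (\<Sum>x\<in>set_pmf ?p. prob H * (pmf ?p x * measure_pmf.prob (run k x) A))"
    by (intro sum_mono IH)
  also have "\<dots> = prob H * measure_pmf.prob (run (Suc k) (h t)) A"
    by (simp add: prob_bind_pmf_eq_sum sum_distrib_left)
  finally show ?case
    by (simp add: H_def)
qed

section \<open>Tail of the resolving time\<close>

lemma less_resolving_time_iff:
  "enat k < resolving_time n E l \<longleftrightarrow> (\<forall>t\<le>k. \<exists>i\<in>{1..n}. \<not> happy (l t) i)"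
proof -
  \<comment> \<open>Passing to a strict inequality with \<open>Suc k\<close> lets
    \<open>Inf_less_iff\<close> unfold the infimum, which also covers the empty set.\<close>
  have "resolving_time n E l \<le> enat k \<longleftrightarrow> resolving_time n E l < enat (Suc k)"
    by (cases "resolving_time n E l") auto
  also have "\<dots> \<longleftrightarrow> (\<exists>t\<le>k. \<forall>i\<in>{1..n}. happy (l t) i)"
    unfolding resolving_time_def payoff_eq_1_iff Inf_less_iff by (auto simp: less_Suc_eq_le)
  finally show ?thesis
    by (auto simp flip: not_le)
qed

lemma measurable_less_resolving_time:
  assumes "\<And>t. L t \<in> M \<rightarrow>\<^sub>M count_space UNIV"
  shows "{\<omega> \<in> space M. enat k < resolving_time n E (\<lambda>t. L t \<omega>)} \<in> sets M"
proof -
  have "{\<omega> \<in> space M. \<forall>t\<le>k. \<exists>i\<in>{1..n}. \<not> happy (L t \<omega>) i} \<in> sets M"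
    using sets_Collect_history
      [where L = L and P = "\<lambda>_ l. \<exists>i\<in>{1..n}. \<not> happy l i", OF assms] .
  then show ?thesis
    unfolding less_resolving_time_iff .
qed

text \<open>A game unresolved through time \<open>2 * t\<close> has a conflict at time
  \<open>2 * t\<close>, and the history bound at time 0 controls that event.\<close>

lemma prob_resolving_time_gt_le:
  assumes game: "greedy_selfish_game M n q E l0 L"
  shows "\<P>(\<omega> in M. enat (2 * t) < resolving_time n E (\<lambda>s. L s \<omega>)) \<le> n * (1 - recovery_prob) ^ t"
proof -
  interpret prob_space M
    using game by (simp add: greedy_selfish_game_def)
  have L: "L t \<in> M \<rightarrow>\<^sub>M count_space UNIV" for t
    using game by (simp add: greedy_selfish_game_def)
  have start: "L 0 \<omega> = l0" if "\<omega> \<in> space M" for \<omega>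
    using that game by (simp add: greedy_selfish_game_def)
  let ?U = "{l. \<exists>i\<in>{1..n}. \<not> happy l i}"
  have "\<P>(\<omega> in M. enat (2 * t) < resolving_time n E (\<lambda>s. L s \<omega>))
      \<le> \<P>(\<omega> in M. (\<forall>s\<le>0. L s \<omega> = l0) \<and> L (0 + 2 * t) \<omega> \<in> ?U)"
  proof (rule finite_measure_mono)
    have "{\<omega> \<in> space M. (\<forall>s\<le>0. L s \<omega> = l0) \<and> L (0 + 2 * t) \<omega> \<in> ?U}
        = {\<omega> \<in> space M. L (2 * t) \<omega> \<in> ?U}"
      by (auto simp: start)
    then show "{\<omega> \<in> space M. (\<forall>s\<le>0. L s \<omega> = l0) \<and> L (0 + 2 * t) \<omega> \<in> ?U} \<in> sets M"
      using sets_Collect_count_space[OF L] by simp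
  qed (auto simp: start less_resolving_time_iff)
  also have "\<dots> \<le> \<P>(\<omega> in M. \<forall>s\<le>0. L s \<omega> = l0) * measure_pmf.prob (run (2 * t) l0) ?U"
    using prob_history_run_le[OF game, of 0 "\<lambda>_. l0" "2 * t"] .
  also have "\<dots> \<le> 1 * measure_pmf.prob (run (2 * t) l0) ?U"
    by (intro mult_right_mono) auto
  also have "\<dots> \<le> n * (1 - recovery_prob) ^ t"
    using prob_conflict_run_le by simp
  finally show ?thesis .
qed

end

section \<open>Choice of the constants\<close>

theorem theorem3:
  fixes E :: "nat \<Rightarrow> nat rel"
    and q :: "nat \<Rightarrow> nat"
    and l0 :: "nat \<Rightarrow> nat \<Rightarrow> nat"
    and M :: "nat \<Rightarrow> 'a measure"
    and L :: "nat \<Rightarrow> nat \<Rightarrow> 'a \<Rightarrow> nat \<Rightarrow> nat"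
    and X :: "nat \<Rightarrow> 'a \<Rightarrow> enat"
  assumes "\<And>n. n \<ge> 1 \<Longrightarrow> simple_graph n (E n)"
    and "\<And>n. n \<ge> 1 \<Longrightarrow> q n \<ge> max_degree n (E n) + 2"
    and "\<And>n. n \<ge> 1 \<Longrightarrow> l0 n \<in> states n (q n)"
    and "\<And>n. n \<ge> 1 \<Longrightarrow> greedy_selfish_game (M n) n (q n) (E n) (l0 n) (L n)"
    and "\<And>n \<omega>. n \<ge> 1 \<Longrightarrow> \<omega> \<in> space (M n) \<Longrightarrow> X n \<omega> = resolving_time n (E n) (\<lambda>t. L n t \<omega>)"
  shows "\<forall>\<epsilon>>0. \<exists>C>0. \<exists>n0. \<forall>n>n0.
           \<P>(\<omega> in M n. ereal_of_enat (X n \<omega>) / ereal (ln (real n)) > ereal C) < \<epsilon>"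
proof (intro allI impI)
  fix \<epsilon> :: real
  assume "\<epsilon> > 0"
  let ?p = recovery_prob
  note p = recovery_prob_bounds
  \<comment> \<open>About \<open>C * ln n / 2\<close> double rounds, each costing a factor
    \<open>exp (- ?p)\<close>, give roughly \<open>exp (- 2 * ln n)\<close>. This beats the factor
    \<open>n\<close> of the union bound and leaves \<open>1 / n\<close>.\<close>
  define C where "C = 4 / ?p"
  have "C > 0"
    using p by (simp add: C_def)
  have "\<P>(\<omega> in M n. ereal_of_enat (X n \<omega>) / ereal (ln (real n)) > ereal C) < \<epsilon>"
    \<comment> \<open>The final bound \<open>exp 1 / n\<close> is below \<epsilon> from here on; the
      summand 1 makes \<open>n > 1\<close>, hence \<open>ln n > 0\<close>, evident.\<close>
    if n: "n > nat \<lceil>exp 1 / \<epsilon>\<rceil> + 1" for n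
  proof -
    interpret greedy_coloring n "q n" "E n"
    proof
      show "simple_graph n (E n)"
        using assms(1) n by simp
      show "card (neighbours (E n) i) + 2 \<le> q n" if "i \<in> {1..n}" for i
      proof -
        have "card (neighbours (E n) i) \<le> max_degree n (E n)"
          unfolding max_degree_def using that by (intro Max_ge) auto
        then show ?thesis
          using assms(2)[of n] n by simp
      qed
    qed
    interpret prob_space "M n"
      using assms(4)[of n] n by (simp add: greedy_selfish_game_def)
    define t where "t = nat \<lfloor>C * ln n / 2\<rfloor>"
    have "ln n > 0"
      using n by simp
    have t: "2 * real t \<le> C * ln n" "C * ln n / 2 - 1 \<le> t"
      using \<open>C > 0\<close> \<open>ln n > 0\<close> unfolding t_def by (simp_all add: of_nat_floor) linarith+
    have late: "enat (2 * t) < resolving_time n (E n) (\<lambda>s. L n s \<omega>)"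
      if "\<omega> \<in> space (M n)" "ereal_of_enat (X n \<omega>) / ereal (ln n) > ereal C" for \<omega>
    proof -
      have "X n \<omega> = resolving_time n (E n) (\<lambda>s. L n s \<omega>)"
        using assms(5) n that(1) by simp
      moreover have "enat (2 * t) < X n \<omega>"
      proof (cases "X n \<omega>")
        case (enat m)
        then have "C < m / ln n"
          using that(2) \<open>ln n > 0\<close> by simp
        then have "C * ln n < m"
          using \<open>ln n > 0\<close> by (simp add: pos_less_divide_eq)
        then have "2 * real t < real m"
          using t(1) by linarith
        then show ?thesis
          using enat by simp
      qed simp
      ultimately show ?thesis
        by simp
    qed
    have "\<P>(\<omega> in M n. ereal_of_enat (X n \<omega>) / ereal (ln (real n)) > ereal C)
        \<le> \<P>(\<omega> in M n. enat (2 * t) < resolving_time n (E n) (\<lambda>s. L n s \<omega>))"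
      using late assms(4)[of n] n
      by (intro finite_measure_mono measurable_less_resolving_time)
        (auto simp: greedy_selfish_game_def)
    also have "\<dots> \<le> n * (1 - ?p) ^ t"
      using prob_resolving_time_gt_le[OF assms(4)[of n]] n by simp
    also have "\<dots> \<le> n * exp (- ?p) ^ t"
      using exp_ge_add_one_self[of "- ?p"] p by (intro mult_left_mono power_mono) auto
    also have "\<dots> = exp (ln n - t * ?p)"
      using n by (simp add: exp_diff exp_minus exp_of_nat_mult divide_inverse power_inverse)
    \<comment> \<open>Rounding \<open>t\<close> down loses at most one double round, that is
      \<open>?p < 1\<close> in the exponent.\<close>
    also have "\<dots> \<le> exp (1 - ln n)"
    proof -
      have "(C * ln n / 2 - 1) * ?p \<le> t * ?p"
        using t(2) p by (intro mult_right_mono) auto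
      then have "2 * ln n - ?p \<le> t * ?p"
        using p by (simp add: C_def left_diff_distrib)
      then have "ln n - t * ?p \<le> 1 - ln n"
        using p by linarith
      then show ?thesis
        by simp
    qed
    also have "\<dots> = exp 1 / n"
      using n by (simp add: exp_diff)
    also have "\<dots> < \<epsilon>"
    proof -
      have "exp 1 / \<epsilon> < n"
        using n by linarith
      then show ?thesis
        using \<open>\<epsilon> > 0\<close> n by (simp add: field_simps)
    qed
    finally show ?thesis .
  qed
  then show "\<exists>C>0. \<exists>n0. \<forall>n>n0.
      \<P>(\<omega> in M n. ereal_of_enat (X n \<omega>) / ereal (ln (real n)) > ereal C) < \<epsilon>"
    using \<open>C > 0\<close> by blast
qed

end
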